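(* Let $R$ be a ring and $M$ an $R$-bimodule. The trivial extension $T(R,M)$ is a $W\Delta U$ ring if and only if $R$ is a $W\Delta U$ ring.
   Context: Rings are associative with identity, not necessarily commutative. The trivial extension is $T(R,M)=\{(r,m): r\in R,\ m\in M\}$ with componentwise addition and multiplication $(r,m)(s,n)=(rs,\ rn+ms)$. $U(S)$ is the group of units of a ring $S$. $\Delta(S)=\{r\in S : r+u\in U(S)\text{ for all }u\in U(S)\}$; equivalently $\Delta(S)=J(T)$, where $T$ is the subring of $S$ generated by $U(S)$ and $J$ denotes the Jacobson radical. $S$ is $W\Delta U$ if $U(S)=\pm 1+\Delta(S)$, i.e. every unit of $S$ has the form $1+d$ or $-1+d$ with $d\in\Delta(S)$. *)

theory Defs
  imports "HOL-Algebra.Module" "HOL-Algebra.AbelCoset"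
begin

text \<open>
  Bimodules over a ring that need not be commutative (the library's modules are over
  commutative rings).  The left action is the library's \<open>smult\<close>; the \<open>mult\<close> and \<open>one\<close>
  fields that the library record for modules inherits from rings are left unconstrained,
  as in the library.
\<close>

record ('a, 'b) bimodule = "('a, 'b) module" +
  rsmult :: "['b, 'a] \<Rightarrow> 'b" (infixl "\<odot>\<^sub>r\<index>" 70)

locale bimodule = R?: ring R + M?: abelian_group M
  for R :: "('a, 'r) ring_scheme" (structure)
    and M :: "('a, 'b, 'm) bimodule_scheme" (structure) +
  assumes smult_closed [simp, intro]:
      "\<lbrakk> r \<in> carrier R; m \<in> carrier M \<rbrakk> \<Longrightarrow> r \<odot>\<^bsub>M\<^esub> m \<in> carrier M"
    and smult_l_distr:
      "\<lbrakk> r \<in> carrier R; s \<in> carrier R; m \<in> carrier M \<rbrakk>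
        \<Longrightarrow> (r \<oplus>\<^bsub>R\<^esub> s) \<odot>\<^bsub>M\<^esub> m = r \<odot>\<^bsub>M\<^esub> m \<oplus>\<^bsub>M\<^esub> s \<odot>\<^bsub>M\<^esub> m"
    and smult_r_distr:
      "\<lbrakk> r \<in> carrier R; m \<in> carrier M; n \<in> carrier M \<rbrakk>
        \<Longrightarrow> r \<odot>\<^bsub>M\<^esub> (m \<oplus>\<^bsub>M\<^esub> n) = r \<odot>\<^bsub>M\<^esub> m \<oplus>\<^bsub>M\<^esub> r \<odot>\<^bsub>M\<^esub> n"
    and smult_assoc1:
      "\<lbrakk> r \<in> carrier R; s \<in> carrier R; m \<in> carrier M \<rbrakk>
        \<Longrightarrow> (r \<otimes>\<^bsub>R\<^esub> s) \<odot>\<^bsub>M\<^esub> m = r \<odot>\<^bsub>M\<^esub> (s \<odot>\<^bsub>M\<^esub> m)"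
    and smult_one [simp]:
      "m \<in> carrier M \<Longrightarrow> \<one>\<^bsub>R\<^esub> \<odot>\<^bsub>M\<^esub> m = m"
    and rsmult_closed [simp, intro]:
      "\<lbrakk> m \<in> carrier M; r \<in> carrier R \<rbrakk> \<Longrightarrow> m \<odot>\<^sub>r\<^bsub>M\<^esub> r \<in> carrier M"
    and rsmult_l_distr:
      "\<lbrakk> m \<in> carrier M; n \<in> carrier M; r \<in> carrier R \<rbrakk>
        \<Longrightarrow> (m \<oplus>\<^bsub>M\<^esub> n) \<odot>\<^sub>r\<^bsub>M\<^esub> r = m \<odot>\<^sub>r\<^bsub>M\<^esub> r \<oplus>\<^bsub>M\<^esub> n \<odot>\<^sub>r\<^bsub>M\<^esub> r"
    and rsmult_r_distr:
      "\<lbrakk> m \<in> carrier M; r \<in> carrier R; s \<in> carrier R \<rbrakk>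
        \<Longrightarrow> m \<odot>\<^sub>r\<^bsub>M\<^esub> (r \<oplus>\<^bsub>R\<^esub> s) = m \<odot>\<^sub>r\<^bsub>M\<^esub> r \<oplus>\<^bsub>M\<^esub> m \<odot>\<^sub>r\<^bsub>M\<^esub> s"
    and rsmult_assoc1:
      "\<lbrakk> m \<in> carrier M; r \<in> carrier R; s \<in> carrier R \<rbrakk>
        \<Longrightarrow> m \<odot>\<^sub>r\<^bsub>M\<^esub> (r \<otimes>\<^bsub>R\<^esub> s) = (m \<odot>\<^sub>r\<^bsub>M\<^esub> r) \<odot>\<^sub>r\<^bsub>M\<^esub> s"
    and rsmult_one [simp]:
      "m \<in> carrier M \<Longrightarrow> m \<odot>\<^sub>r\<^bsub>M\<^esub> \<one>\<^bsub>R\<^esub> = m"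
    and smult_rsmult_assoc:
      "\<lbrakk> r \<in> carrier R; m \<in> carrier M; s \<in> carrier R \<rbrakk>
        \<Longrightarrow> (r \<odot>\<^bsub>M\<^esub> m) \<odot>\<^sub>r\<^bsub>M\<^esub> s = r \<odot>\<^bsub>M\<^esub> (m \<odot>\<^sub>r\<^bsub>M\<^esub> s)"

definition trivial_extension ::
    "('a, 'r) ring_scheme \<Rightarrow> ('a, 'b, 'm) bimodule_scheme \<Rightarrow> ('a \<times> 'b) ring"
  where "trivial_extension R M =
    \<lparr> carrier = carrier R \<times> carrier M,
      mult = (\<lambda>(r, m) (s, n). (r \<otimes>\<^bsub>R\<^esub> s, r \<odot>\<^bsub>M\<^esub> n \<oplus>\<^bsub>M\<^esub> m \<odot>\<^sub>r\<^bsub>M\<^esub> s)),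
      one = (\<one>\<^bsub>R\<^esub>, \<zero>\<^bsub>M\<^esub>),
      zero = (\<zero>\<^bsub>R\<^esub>, \<zero>\<^bsub>M\<^esub>),
      add = (\<lambda>(r, m) (s, n). (r \<oplus>\<^bsub>R\<^esub> s, m \<oplus>\<^bsub>M\<^esub> n)) \<rparr>"

definition Delta :: "('a, 's) ring_scheme \<Rightarrow> 'a set"
  where "Delta S = {r \<in> carrier S. \<forall>u \<in> Units S. r \<oplus>\<^bsub>S\<^esub> u \<in> Units S}"

locale WDeltaU_ring = ring S for S :: "('a, 's) ring_scheme" (structure) +
  assumes Units_eq: "Units S = (\<one>\<^bsub>S\<^esub> <+\<^bsub>S\<^esub> Delta S) \<union> (\<ominus>\<^bsub>S\<^esub> \<one>\<^bsub>S\<^esub> <+\<^bsub>S\<^esub> Delta S)"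

lemma (in bimodule) smult_zero [simp]:
  assumes "r \<in> carrier R" shows "r \<odot>\<^bsub>M\<^esub> \<zero>\<^bsub>M\<^esub> = \<zero>\<^bsub>M\<^esub>"
proof -
  have "r \<odot>\<^bsub>M\<^esub> \<zero>\<^bsub>M\<^esub> \<oplus>\<^bsub>M\<^esub> r \<odot>\<^bsub>M\<^esub> \<zero>\<^bsub>M\<^esub> = r \<odot>\<^bsub>M\<^esub> \<zero>\<^bsub>M\<^esub>"
    using smult_r_distr[of r "\<zero>\<^bsub>M\<^esub>" "\<zero>\<^bsub>M\<^esub>"] assms by simp
  then show ?thesis using assms by (simp add: M.add.l_cancel_one)
qed

lemma (in bimodule) zero_rsmult [simp]:
  assumes "r \<in> carrier R" shows "\<zero>\<^bsub>M\<^esub> \<odot>\<^sub>r\<^bsub>M\<^esub> r = \<zero>\<^bsub>M\<^esub>"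
proof -
  have "\<zero>\<^bsub>M\<^esub> \<odot>\<^sub>r\<^bsub>M\<^esub> r \<oplus>\<^bsub>M\<^esub> \<zero>\<^bsub>M\<^esub> \<odot>\<^sub>r\<^bsub>M\<^esub> r = \<zero>\<^bsub>M\<^esub> \<odot>\<^sub>r\<^bsub>M\<^esub> r"
    using rsmult_l_distr[of "\<zero>\<^bsub>M\<^esub>" "\<zero>\<^bsub>M\<^esub>" r] assms by simp
  then show ?thesis using assms by (simp add: M.add.l_cancel_one)
qed

lemma (in bimodule) trivial_extension_ring: "ring (trivial_extension R M)"
proof (rule ringI)
  show "abelian_group (trivial_extension R M)"
  proof (rule abelian_groupI)
    fix x assume "x \<in> carrier (trivial_extension R M)"
    then show "\<exists>y\<in>carrier (trivial_extension R M).
        y \<oplus>\<^bsub>trivial_extension R M\<^esub> x = \<zero>\<^bsub>trivial_extension R M\<^esub>"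
      by (intro bexI[of _ "(\<ominus>\<^bsub>R\<^esub> fst x, \<ominus>\<^bsub>M\<^esub> snd x)"])
        (auto simp: trivial_extension_def R.l_neg M.l_neg)
  qed (auto simp: trivial_extension_def R.a_ac M.a_ac)
  show "monoid (trivial_extension R M)"
    by (rule monoidI)
      (auto simp: trivial_extension_def R.m_assoc smult_r_distr rsmult_l_distr
        smult_assoc1 rsmult_assoc1 smult_rsmult_assoc M.a_assoc)
qed (auto simp: trivial_extension_def R.l_distr R.r_distr smult_l_distr smult_r_distr
      rsmult_l_distr rsmult_r_distr M.a_ac)

end

theory Submission
  imports Defs
begin

text \<open>
  An element \<open>(r, m)\<close> is a unit of the trivial extension iff \<open>r\<close> is a unit of \<open>R\<close>, as \<open>0 \<times> M\<close>
  squares to zero. Hence \<open>Units\<close>, then \<open>Delta\<close>, and then both cosets \<open>\<plusminus>1 + Delta\<close> of the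
  trivial extension are those of \<open>R\<close> times \<open>M\<close>, and the nonempty factor \<open>M\<close> cancels.
\<close>

context bimodule
begin

lemma zero_smult:
  assumes "m \<in> carrier M" shows "\<zero>\<^bsub>R\<^esub> \<odot>\<^bsub>M\<^esub> m = \<zero>\<^bsub>M\<^esub>"
proof -
  have "\<zero>\<^bsub>R\<^esub> \<odot>\<^bsub>M\<^esub> m \<oplus>\<^bsub>M\<^esub> \<zero>\<^bsub>R\<^esub> \<odot>\<^bsub>M\<^esub> m = \<zero>\<^bsub>R\<^esub> \<odot>\<^bsub>M\<^esub> m"
    using smult_l_distr[of "\<zero>\<^bsub>R\<^esub>" "\<zero>\<^bsub>R\<^esub>" m] assms by simp
  then show ?thesis using assms by (simp add: M.add.l_cancel_one)
qed

lemma smult_l_neg: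
  assumes "r \<in> carrier R" "m \<in> carrier M"
  shows "(\<ominus>\<^bsub>R\<^esub> r) \<odot>\<^bsub>M\<^esub> m \<oplus>\<^bsub>M\<^esub> r \<odot>\<^bsub>M\<^esub> m = \<zero>\<^bsub>M\<^esub>"
  using smult_l_distr[of "\<ominus>\<^bsub>R\<^esub> r" r m] assms by (simp add: R.l_neg zero_smult)

lemma Units_trivial_extension:
  "Units (trivial_extension R M) = Units R \<times> carrier M"
proof (intro equalityI subsetI)
  fix x assume "x \<in> Units (trivial_extension R M)"
  \<comment> \<open>The first component of an inverse of \<open>x\<close> inverts the first
    component of \<open>x\<close>.\<close>
  then show "x \<in> Units R \<times> carrier M"
    by (auto simp: Units_def trivial_extension_def)
next
  fix x assume "x \<in> Units R \<times> carrier M"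
  then obtain u m where x: "x = (u, m)" and u: "u \<in> Units R" and m: "m \<in> carrier M"
    by auto
  define v where "v = inv\<^bsub>R\<^esub> u"
  have uc: "u \<in> carrier R" and v: "v \<in> carrier R" and uv: "u \<otimes>\<^bsub>R\<^esub> v = \<one>\<^bsub>R\<^esub>"
    and vu: "v \<otimes>\<^bsub>R\<^esub> u = \<one>\<^bsub>R\<^esub>"
    using u by (auto simp: v_def)
  \<comment> \<open>Solving \<open>u n + m v = 0\<close> for \<open>n\<close> forces
    \<open>n = -v m v\<close>, so \<open>(v, n)\<close> is the only candidate for the
    inverse.\<close>
  define n where "n = (\<ominus>\<^bsub>R\<^esub> v) \<odot>\<^bsub>M\<^esub> (m \<odot>\<^sub>r\<^bsub>M\<^esub> v)"
  have n: "n \<in> carrier M" using m v by (simp add: n_def)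
  have "u \<odot>\<^bsub>M\<^esub> n = (\<ominus>\<^bsub>R\<^esub> \<one>\<^bsub>R\<^esub>) \<odot>\<^bsub>M\<^esub> (m \<odot>\<^sub>r\<^bsub>M\<^esub> v)"
    using smult_assoc1[of u "\<ominus>\<^bsub>R\<^esub> v" "m \<odot>\<^sub>r\<^bsub>M\<^esub> v"] uc v m uv
    by (simp add: n_def R.r_minus)
  then have right: "u \<odot>\<^bsub>M\<^esub> n \<oplus>\<^bsub>M\<^esub> m \<odot>\<^sub>r\<^bsub>M\<^esub> v = \<zero>\<^bsub>M\<^esub>"
    using smult_l_neg[of "\<one>\<^bsub>R\<^esub>" "m \<odot>\<^sub>r\<^bsub>M\<^esub> v"] m v by simp
  \<comment> \<open>Compatibility of the two actions lets \<open>u\<close> meet the inner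
    \<open>v\<close> on the right, where \<open>v u = 1\<close> cancels.\<close>
  have "n \<odot>\<^sub>r\<^bsub>M\<^esub> u = (\<ominus>\<^bsub>R\<^esub> v) \<odot>\<^bsub>M\<^esub> m"
    using smult_rsmult_assoc[of "\<ominus>\<^bsub>R\<^esub> v" "m \<odot>\<^sub>r\<^bsub>M\<^esub> v" u] rsmult_assoc1[of m v u] uc v m vu
    by (simp add: n_def)
  then have left: "v \<odot>\<^bsub>M\<^esub> m \<oplus>\<^bsub>M\<^esub> n \<odot>\<^sub>r\<^bsub>M\<^esub> u = \<zero>\<^bsub>M\<^esub>"
    using smult_l_neg[of v m] v m by (simp add: M.a_comm)
  show "x \<in> Units (trivial_extension R M)"
    unfolding Units_def x using uc v m n uv vu left right
    by (auto simp: trivial_extension_def intro!: bexI[of _ "(v, n)"])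
qed

text \<open>Whether a sum is a unit depends only on first components, and every unit of
  \<open>R\<close> is the first component of some unit of the extension since
  \<open>carrier M\<close> contains zero.\<close>

lemma Delta_trivial_extension:
  "Delta (trivial_extension R M) = Delta R \<times> carrier M"
  unfolding Delta_def Units_trivial_extension
  by (auto simp: trivial_extension_def)

lemma uminus_one_trivial_extension:
  "\<ominus>\<^bsub>trivial_extension R M\<^esub> \<one>\<^bsub>trivial_extension R M\<^esub> = (\<ominus>\<^bsub>R\<^esub> \<one>\<^bsub>R\<^esub>, \<zero>\<^bsub>M\<^esub>)"
proof -
  interpret T: ring "trivial_extension R M" by (rule trivial_extension_ring)
  show ?thesis
    \<comment> \<open>Additive inverses are unique, so it is enough that the pair adds up to zero
      with the identity.\<close>
    by (rule T.minus_equality) (auto simp: trivial_extension_def R.l_neg)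
qed

text \<open>Adding zero fixes every element of \<open>carrier M\<close>. Keeping \<open>r\<close>
  general covers both 1 and -1.\<close>

lemma coset_trivial_extension:
  "(r, \<zero>\<^bsub>M\<^esub>) <+\<^bsub>trivial_extension R M\<^esub> (A \<times> carrier M) = (r <+\<^bsub>R\<^esub> A) \<times> carrier M"
  by (force simp: a_l_coset_def' trivial_extension_def)

end

theorem proposition4p8:
  fixes R :: "('a, 'r) ring_scheme" and M :: "('a, 'b, 'm) bimodule_scheme"
  assumes "ring R" and "bimodule R M"
  shows "WDeltaU_ring (trivial_extension R M) \<longleftrightarrow> WDeltaU_ring R"
proof -
  interpret bimodule R M by (rule assms(2))
  let ?T = "trivial_extension R M"
  have "\<one>\<^bsub>?T\<^esub> = (\<one>\<^bsub>R\<^esub>, \<zero>\<^bsub>M\<^esub>)"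
    by (simp add: trivial_extension_def)
  then have "\<one>\<^bsub>?T\<^esub> <+\<^bsub>?T\<^esub> Delta ?T = (\<one>\<^bsub>R\<^esub> <+\<^bsub>R\<^esub> Delta R) \<times> carrier M"
    by (simp add: Delta_trivial_extension coset_trivial_extension)
  moreover have "\<ominus>\<^bsub>?T\<^esub> \<one>\<^bsub>?T\<^esub> <+\<^bsub>?T\<^esub> Delta ?T = (\<ominus>\<^bsub>R\<^esub> \<one>\<^bsub>R\<^esub> <+\<^bsub>R\<^esub> Delta R) \<times> carrier M"
    by (simp add: uminus_one_trivial_extension Delta_trivial_extension coset_trivial_extension)
  \<comment> \<open>Compare the elements whose second component is the zero of
    \<open>M\<close>.\<close>
  moreover have "A \<times> carrier M = B \<times> carrier M \<longleftrightarrow> A = B" for A B :: "'a set"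
    using M.zero_closed by blast
  \<comment> \<open>Both sides being rings, only the equations for units remain; the flipped rule
    merges the two cosets into one product with \<open>carrier M\<close>, which then
    cancels.\<close>
  ultimately show ?thesis
    using assms(1) trivial_extension_ring
    by (simp add: WDeltaU_ring_def WDeltaU_ring_axioms_def Units_trivial_extension
        flip: Sigma_Un_distrib1)
qed

end
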